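(* Fix an integer $i$ and consider the sequence $(c_i(N))_{N\ge1}$. A vertical run of $1$'s in digit position $i$ is a maximal set of consecutive natural numbers $N$ with $c_i(N)=1$. Then: for $i\ge1$, every run of $1$'s in position $i$ has length $L_{i-1}$; for $i\le 0$, every run of $1$'s in position $i$ has length $L_{-i}$, with the single exception that in position $i=0$ the first run (consisting of $N=1$) has length $1$. In particular only Lucas numbers occur as lengths of vertical runs of $1$'s (apart from that exception), and every Lucas number $L_n$, $n\ge0$, occurs as such a run length.
   Context: Let $\varphi=(1+\sqrt5)/2$. Lucas numbers: $L_0=2$, $L_1=1$, $L_n=L_{n-1}+L_{n-2}$ for $n\ge2$. The Bergman representation $\beta(N)$ is the unique finite expansion $N=\sum_i d_i\varphi^i$ with digits in $\{0,1\}$ and no two consecutive digits $11$. The canonical representation $\gamma(N)$: if $N$ has a finite representation $N=\sum_ic_i\varphi^i$ with digits in $\{0,1\}$, $c_1=c_0=1$, and $c_{i+1}c_i\ne11$ for all $i\ne0$, then $\gamma(N)$ is this (unique) representation; otherwise $\gamma(N)=\beta(N)$. $c_i(N)$ denotes the digit of index $i$ in $\gamma(N)$, taken to be $0$ for indices outside the range of nonzero digits. *)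

theory Defs
  imports Complex_Main
begin

fun lucas :: "nat \<Rightarrow> nat" where
  "lucas 0 = 2"
| "lucas (Suc 0) = 1"
| "lucas (Suc (Suc n)) = lucas (Suc n) + lucas n"

definition golden_ratio :: real where
  "golden_ratio = (1 + sqrt 5) / 2"

text \<open>A digit string is a function on all integer positions, zero outside a finite set.\<close>

definition represents :: "(int \<Rightarrow> nat) \<Rightarrow> nat \<Rightarrow> bool" where
  "represents d N \<longleftrightarrow>
     finite {i. d i \<noteq> 0} \<and> (\<forall>i. d i \<in> {0, 1}) \<and>
     real N = (\<Sum>i | d i \<noteq> 0. real (d i) * golden_ratio powi i)"

definition is_bergman :: "(int \<Rightarrow> nat) \<Rightarrow> nat \<Rightarrow> bool" where
  "is_bergman d N \<longleftrightarrow>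
     represents d N \<and> (\<forall>i. \<not> (d (i + 1) = 1 \<and> d i = 1))"

definition bergman :: "nat \<Rightarrow> int \<Rightarrow> nat" where
  "bergman N = (THE d. is_bergman d N)"

definition is_canonical11 :: "(int \<Rightarrow> nat) \<Rightarrow> nat \<Rightarrow> bool" where
  "is_canonical11 c N \<longleftrightarrow>
     represents c N \<and> c 1 = 1 \<and> c 0 = 1 \<and>
     (\<forall>i. i \<noteq> 0 \<longrightarrow> \<not> (c (i + 1) = 1 \<and> c i = 1))"

definition canonical :: "nat \<Rightarrow> int \<Rightarrow> nat" where
  "canonical N =
     (if \<exists>c. is_canonical11 c N then (THE c. is_canonical11 c N) else bergman N)"

definition consecutive :: "nat set \<Rightarrow> bool" where
  "consecutive R \<longleftrightarrow> (\<forall>a\<in>R. \<forall>b\<in>R. {a..b} \<subseteq> R)"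

text \<open>The digit sequence starts at 1, so runs are sets of positive integers.\<close>

definition ones_block :: "int \<Rightarrow> nat set \<Rightarrow> bool" where
  "ones_block i R \<longleftrightarrow>
     R \<noteq> {} \<and> consecutive R \<and> (\<forall>N\<in>R. N \<ge> 1 \<and> canonical N i = 1)"

definition vertical_run :: "int \<Rightarrow> nat set \<Rightarrow> bool" where
  "vertical_run i R \<longleftrightarrow>
     ones_block i R \<and> (\<forall>S. ones_block i S \<and> R \<subseteq> S \<longrightarrow> S = R)"

end

theory Submission
  imports Defs
begin

text \<open>
  Let \<open>c\<close> be the digits of \<open>\<gamma>(N)\<close>.  Estimating the conjugate of the part of the expansion with positive
  indices shows \<open>N - 1 = (\<Sum>i\<ge>1. c\<^sub>i L\<^sub>i) + [c\<^sub>1 = c\<^sub>0 = 1]\<close>, and as \<open>2 * N\<close> is the trace of \<open>N\<close>, also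
  \<open>N = (\<Sum>k\<ge>0. (-1)\<^sup>k c\<^bsub>-k\<^esub> L\<^sub>k) - 1 - [c\<^sub>1 = c\<^sub>0 = 1]\<close>.  Both are numeration systems in which the
  numbers with prescribed digits beyond place \<open>k\<close> and digit 1 at place \<open>k\<close> form an
  interval of \<open>L\<^sub>k\<close> integers (\<open>L\<^bsub>i-1\<^esub>\<close> for \<open>i = k + 1\<close> in the first system), and no two such
  intervals for the same \<open>k\<close> are adjacent.  The exceptional run arises because the interval
  \<open>{0, 1}\<close> for \<open>i = 0\<close> contains the number 0, which is not counted.
\<close>

section \<open>Nested interval numeration\<close>

definition admissible :: "(nat \<Rightarrow> nat) \<Rightarrow> bool" where
  "admissible u \<longleftrightarrow> finite {k. u k \<noteq> 0} \<and> (\<forall>k. u k \<in> {0, 1}) \<and> (\<forall>k. u k = 1 \<longrightarrow> u (Suc k) = 0)"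

lemma admissible_01: "admissible u \<Longrightarrow> u k = 0 \<or> u k = 1"
  by (auto simp: admissible_def)

lemma admissible_Suc: "admissible u \<Longrightarrow> u k = 1 \<Longrightarrow> u (Suc k) = 0"
  by (auto simp: admissible_def)

lemma admissible_upd_0: "admissible u \<Longrightarrow> admissible (u(m := 0))"
  unfolding admissible_def by (auto elim: finite_subset[rotated])

lemma admissible_upd_1:
  assumes "admissible u" "\<And>k. Suc k \<ge> m \<Longrightarrow> u k = 0"
  shows "admissible (u(m := 1))"
proof -
  have "{k. (u(m := 1)) k \<noteq> 0} \<subseteq> insert m {k. u k \<noteq> 0}" by auto
  then have "finite {k. (u(m := 1)) k \<noteq> 0}"
    by (rule finite_subset) (use assms(1) in \<open>simp add: admissible_def\<close>)
  moreover have "(u(m := 1)) (Suc k) = 0" if "(u(m := 1)) k = 1" for k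
  proof (cases "k = m")
    case True
    then show ?thesis using assms(2)[of "Suc k"] by simp
  next
    case False
    then have "u k = 1" using that by simp
    moreover have "u (Suc k) = 0" using \<open>u k = 1\<close> assms(1) by (simp add: admissible_def)
    ultimately show ?thesis using assms(2)[of k] by fastforce
  qed
  ultimately show ?thesis using assms(1) unfolding admissible_def by simp
qed

lemma admissible_shift:
  assumes "admissible u" shows "admissible (\<lambda>k. u (Suc k))"
proof -
  have "finite (Suc -` {k. u k \<noteq> 0})"
    using assms by (intro finite_vimageI) (auto simp: admissible_def)
  then show ?thesis using assms unfolding admissible_def by (auto simp: vimage_def)
qed

lemma admissible_case_nat:
  assumes "admissible u" "d \<in> {0, 1}" "d = 1 \<Longrightarrow> u 0 = 0"
  shows "admissible (case_nat d u)"
proof -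
  have "{k. case_nat d u k \<noteq> 0} \<subseteq> insert 0 (Suc ` {k. u k \<noteq> 0})"
  proof
    fix k assume "k \<in> {k. case_nat d u k \<noteq> 0}"
    then show "k \<in> insert 0 (Suc ` {k. u k \<noteq> 0})" by (cases k) auto
  qed
  then have "finite {k. case_nat d u k \<noteq> 0}"
    by (rule finite_subset) (use assms(1) in \<open>simp add: admissible_def\<close>)
  then show ?thesis using assms unfolding admissible_def by (auto split: nat.splits)
qed

text \<open>Interval \<open>D (k + 2)\<close> is the disjoint union of \<open>D (k + 1)\<close>, which collects the values of the
  strings with digit 0 at place \<open>k\<close>, and of a translate of \<open>D k\<close> by the weight \<open>w k\<close>, for digit 1.\<close>

locale nested_numeration =
  fixes w s l :: "nat \<Rightarrow> int"
  assumes l_pos: "l k > 0"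
    and l_rec: "l (Suc (Suc k)) = l (Suc k) + l k"
    and adjacent: "(s (Suc (Suc k)) = s (Suc k) \<and> w k + s k = s (Suc k) + l (Suc k)) \<or>
      (s (Suc (Suc k)) = w k + s k \<and> w k + s k + l k = s (Suc k))"
begin

definition D :: "nat \<Rightarrow> int set" where
  "D k = {s k..<s k + l k}"

definition tail :: "nat \<Rightarrow> (nat \<Rightarrow> nat) \<Rightarrow> int" where
  "tail m u = (\<Sum>k | u k \<noteq> 0 \<and> m \<le> k. int (u k) * w k)"

text \<open>Only the digits from place \<open>m\<close> on are tested: the remainder must lie in the
  interval that the lower places can fill. A digit 1 at \<open>m\<close> forces 0 just below it,
  hence the smaller \<open>D m\<close>. For \<open>m = 0\<close> the interval \<open>D 0\<close> is
  the slack that will absorb the correction term for the pair 11.\<close>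

definition fits :: "int \<Rightarrow> (nat \<Rightarrow> nat) \<Rightarrow> nat \<Rightarrow> bool" where
  "fits x u m \<longleftrightarrow> x - tail m u \<in> D (if u m = 1 then m else Suc m)"

lemma D_Suc_Suc: "x \<in> D (Suc (Suc k)) \<longleftrightarrow> x \<in> D (Suc k) \<or> x - w k \<in> D k"
  using adjacent[of k] l_rec[of k] l_pos[of k] l_pos[of "Suc k"]
  unfolding D_def atLeastLessThan_iff by linarith

lemma D_disjoint: "x \<in> D (Suc k) \<Longrightarrow> x - w k \<in> D k \<Longrightarrow> False"
  using adjacent[of k] unfolding D_def by auto

lemma tail_eq:
  assumes "admissible u"
  shows "tail m u = int (u m) * w m + tail (Suc m) u"
proof (cases "u m = 0")
  case True
  then have "{k. u k \<noteq> 0 \<and> m \<le> k} = {k. u k \<noteq> 0 \<and> Suc m \<le> k}"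
    by (auto simp: Suc_le_eq le_less)
  then show ?thesis using True by (simp add: tail_def)
next
  case False
  then have "{k. u k \<noteq> 0 \<and> m \<le> k} = insert m {k. u k \<noteq> 0 \<and> Suc m \<le> k}"
    by (auto simp: Suc_le_eq le_less)
  then show ?thesis using assms by (simp add: tail_def admissible_def)
qed

lemma tail_cong: "(\<And>k. m \<le> k \<Longrightarrow> u k = v k) \<Longrightarrow> tail m u = tail m v"
  unfolding tail_def by (intro sum.cong) auto

lemma tail_0_eq:
  assumes "\<And>k. n \<le> k \<Longrightarrow> u k = 0"
  shows "tail 0 u = (\<Sum>k<n. int (u k) * w k)"
  unfolding tail_def using assms by (intro sum.mono_neutral_left) (auto, metis leI less_irrefl)

lemma fits_0:
  assumes "admissible u" "u m = 0"
  shows "fits x u m \<longleftrightarrow> x - tail (Suc m) u \<in> D (Suc m)"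
  using assms by (simp add: fits_def tail_eq[of u m])

lemma fits_1:
  assumes "admissible u" "u m = 1"
  shows "fits x u m \<longleftrightarrow> x - tail (Suc m) u - w m \<in> D m"
  using assms by (simp add: fits_def tail_eq[of u m] algebra_simps)

text \<open>Forgetting the digit at place \<open>m\<close> moves it into the remainder. Both parts
  of \<open>D (m + 2)\<close> occur, and a digit 1 at \<open>m\<close> is harmless because the digit
  at \<open>m + 1\<close> is then 0.\<close>

lemma fits_Suc:
  assumes "admissible u" "fits x u m"
  shows "fits x u (Suc m)"
proof (cases "u m = 1")
  case True
  then have "u (Suc m) = 0" using assms(1) by (auto simp: admissible_def)
  moreover have "x - tail (Suc m) u - w m \<in> D m" using assms fits_1[OF assms(1) True] by simp
  ultimately show ?thesis by (simp add: D_Suc_Suc fits_def)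
next
  case False
  then have "u m = 0" using assms(1) by (auto simp: admissible_def)
  then have "x - tail (Suc m) u \<in> D (Suc m)" using assms fits_0 by blast
  then show ?thesis by (simp add: D_Suc_Suc fits_def)
qed

lemma fits_mono:
  assumes "admissible u" "fits x u m" "m \<le> k"
  shows "fits x u k"
  using assms(3) by (induction rule: dec_induct) (auto intro: assms fits_Suc)

text \<open>At the largest place where the strings differ, the digits beyond agree, so the same
  remainder would lie in both disjoint parts of the interval there.\<close>

lemma fits_unique:
  assumes "admissible u" "admissible v" "fits x u m" "fits x v m" "m \<le> k"
  shows "u k = v k"
proof (rule ccontr)
  define M where "M = Max {k. u k \<noteq> v k \<and> m \<le> k}"
  have "{k. u k \<noteq> v k \<and> m \<le> k} \<subseteq> {k. u k \<noteq> 0} \<union> {k. v k \<noteq> 0}" by auto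
  then have fin: "finite {k. u k \<noteq> v k \<and> m \<le> k}"
    using assms(1,2) by (auto simp: admissible_def elim: finite_subset)
  assume "u k \<noteq> v k"
  then have "M \<in> {k. u k \<noteq> v k \<and> m \<le> k}"
    unfolding M_def using fin assms(5) by (intro Max_in) auto
  then have M: "u M \<noteq> v M" "m \<le> M" by auto
  have "u j = v j" if "Suc M \<le> j" for j
    using Max_ge[OF fin, of j] that M(2) by (fold M_def) force
  then have t: "tail (Suc M) u = tail (Suc M) v" by (rule tail_cong)
  have f: "fits x u M" "fits x v M" using assms fits_mono M by blast+
  have "(u M = 0 \<and> v M = 1) \<or> (u M = 1 \<and> v M = 0)"
    using M(1) admissible_01[OF assms(1), of M] admissible_01[OF assms(2), of M] by auto
  then show False
    using f t assms(1,2) D_disjoint by (auto simp: fits_0 fits_1)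
qed

lemma fits_upd_0:
  assumes "admissible u"
  shows "fits x (u(m := 0)) m \<longleftrightarrow> x - tail (Suc m) u \<in> D (Suc m)"
proof -
  have "tail (Suc m) (u(m := 0)) = tail (Suc m) u" by (rule tail_cong) auto
  then show ?thesis using assms by (simp add: fits_0 admissible_upd_0)
qed

text \<open>Two neighbours with digit 1 at place \<open>m\<close> lie in the same translate of \<open>D m\<close>: next to that
  translate there is always, on a side depending only on \<open>m\<close>, a nonempty translate of
  \<open>D (Suc m)\<close>, where the digit is 0.\<close>

lemma fits_neighbour:
  assumes "admissible u" "admissible v" "u m = 1" "v m = 1" "fits x u m" "fits (x + 1) v m"
  shows "fits (x + 1) u m" and "fits x v m"
proof -
  have agree: "fits (x + 1) u m \<and> fits x v m" if "fits x v m \<or> fits (x + 1) u m"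
  proof -
    have "u k = v k" if "m \<le> k" for k
      using \<open>fits x v m \<or> fits (x + 1) u m\<close>
        fits_unique[OF assms(1,2,5) _ that] fits_unique[OF assms(1,2) _ assms(6) that] by blast
    then have "tail m u = tail m v" by (rule tail_cong)
    then show ?thesis using assms(3-6) by (simp add: fits_def)
  qed
  have "fits x v m \<or> fits (x + 1) u m"
  proof (rule ccontr)
    assume "\<not> (fits x v m \<or> fits (x + 1) u m)"
    then have "x - tail (Suc m) v - w m \<notin> D m" "x + 1 - tail (Suc m) u - w m \<notin> D m"
      using fits_1[OF assms(2,4)] fits_1[OF assms(1,3)] by blast+
    moreover have "x + 1 - tail (Suc m) v - w m \<in> D m" "x - tail (Suc m) u - w m \<in> D m"
      using fits_1[OF assms(2,4)] fits_1[OF assms(1,3)] assms(5,6) by blast+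
    \<comment> \<open>So \<open>x\<close> sits just below the translate belonging to
      \<open>v\<close>, and \<open>x + 1\<close> just above the one belonging to
      \<open>u\<close>.\<close>
    ultimately have *: "x - tail (Suc m) v = s m + w m - 1" "x + 1 - tail (Suc m) u = s m + l m + w m"
      unfolding D_def atLeastLessThan_iff by linarith+
    \<comment> \<open>By \<open>adjacent\<close>, the interval for digit 0 touches the translate
      either from below, where it catches \<open>x\<close>, or from above, where it catches
      \<open>x + 1\<close>. That number then gets digit 0 at \<open>m\<close> besides its digit
      1.\<close>
    have "x - tail (Suc m) v \<in> D (Suc m) \<or> x + 1 - tail (Suc m) u \<in> D (Suc m)"
      unfolding * D_def atLeastLessThan_iff using adjacent[of m] l_pos[of "Suc m"] by linarith
    then have "fits x (v(m := 0)) m \<or> fits (x + 1) (u(m := 0)) m"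
      using fits_upd_0[OF assms(1)] fits_upd_0[OF assms(2)] by blast
    then show False
      using fits_unique[OF admissible_upd_0[OF assms(2), of m] assms(1) _ assms(5) order_refl]
        fits_unique[OF admissible_upd_0[OF assms(1), of m] assms(2) _ assms(6) order_refl] assms(3,4)
      by auto
  qed
  then show "fits (x + 1) u m" and "fits x v m" using agree by auto
qed

text \<open>Splitting \<open>D (q + 1)\<close> decides the top digit, at place
  \<open>p = q - 1\<close>. If it is 1, the remainder lies in \<open>D p\<close> and is expanded
  with places below \<open>p - 1\<close> only, so the new 1 has no neighbour.\<close>

lemma fits_exists:
  assumes "x \<in> D (Suc q)"
  shows "\<exists>u. admissible u \<and> (\<forall>k\<ge>q. u k = 0) \<and> fits x u 0"
  using assms
proof (induction q arbitrary: x rule: less_induct)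
  case (less q)
  have zero: "admissible (\<lambda>_. 0)" by (simp add: admissible_def)
  show ?case
  proof (cases q)
    case 0
    then have "fits x (\<lambda>_. 0) 0" using less.prems by (simp add: fits_def tail_def)
    then show ?thesis using zero by (intro exI[of _ "\<lambda>_. 0"] conjI) simp_all
  next
    case (Suc p)
    then consider "x \<in> D (Suc p)" | "x - w p \<in> D p"
      using less.prems D_Suc_Suc[of x p] by auto
    then show ?thesis
    proof cases
      case 1
      then obtain u where u: "admissible u" "\<forall>k\<ge>p. u k = 0" "fits x u 0"
        using less.IH[of p x] Suc by auto
      then show ?thesis using Suc by (intro exI[of _ u] conjI) simp_all
    next
      case x: 2
      show ?thesis
      proof (cases p)
        case 0
        define v :: "nat \<Rightarrow> nat" where "v = (\<lambda>_. 0)(0 := 1)"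
        have v: "admissible v" unfolding v_def using zero by (rule admissible_upd_1) simp
        have "tail (Suc 0) v = 0" by (simp add: tail_def v_def)
        then have "fits x v 0" using fits_1[OF v, of 0 x] x 0 by (simp add: v_def)
        moreover have "\<forall>k\<ge>q. v k = 0" using Suc by (simp add: v_def)
        ultimately show ?thesis using v by blast
      next
        case r: (Suc r)
        obtain u where u: "admissible u" "\<forall>k\<ge>r. u k = 0" "fits (x - w p) u 0"
          using less.IH[of r "x - w p"] x Suc r by auto
        define v where "v = u(p := 1)"
        have v: "admissible v" unfolding v_def
          by (rule admissible_upd_1[OF u(1)]) (use u(2) r in simp)
        have "tail 0 v = (\<Sum>k<Suc p. int (v k) * w k)"
          by (rule tail_0_eq) (use u(2) r in \<open>simp add: v_def\<close>)
        also have "\<dots> = (\<Sum>k<p. int (u k) * w k) + w p"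
          by (simp add: v_def)
        also have "(\<Sum>k<p. int (u k) * w k) = tail 0 u"
          by (rule tail_0_eq[symmetric]) (use u(2) r in simp)
        finally have "tail 0 v = tail 0 u + w p" .
        then have "fits x v 0" using u(3) r by (simp add: fits_def v_def algebra_simps)
        moreover have "\<forall>k\<ge>q. v k = 0" using u(2) Suc r by (simp add: v_def)
        ultimately show ?thesis using v by blast
      qed
    qed
  qed
qed

text \<open>The numbers that fit the digits of \<open>n\<close> from place \<open>m\<close> on form
  an interval of length \<open>l m\<close>; uniqueness gives them all digit 1 at \<open>m\<close>,
  and \<open>fits_neighbour\<close> excludes the two numbers next to it. The left end is an integer,
  as the interval is not yet known to consist of natural numbers.\<close>

lemma digit_run:
  fixes c :: "nat \<Rightarrow> nat \<Rightarrow> nat"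
  assumes c: "\<And>n. admissible (c n)" "\<And>n. fits (int n) (c n) 0" and "c n m = 1"
  obtains a where "a \<le> int n" "int n < a + l m"
    "\<And>x. a \<le> int x \<Longrightarrow> int x < a + l m \<Longrightarrow> c x m = 1"
    "\<And>x. int x = a - 1 \<or> int x = a + l m \<Longrightarrow> c x m \<noteq> 1"
proof
  define a where "a = tail (Suc m) (c n) + w m + s m"
  have in_run: "fits y (c n) m \<longleftrightarrow> a \<le> y \<and> y < a + l m" for y
    using c(1) assms(3) by (simp add: fits_1 D_def a_def) auto
  have f: "fits (int x) (c x) m" for x using c fits_mono by blast
  show "a \<le> int n" "int n < a + l m" using f in_run by auto
  show "c x m = 1" if "a \<le> int x" "int x < a + l m" for x
    using fits_unique[OF c(1) c(1) f, of x n m] in_run[of "int x"] that assms(3) by auto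
  show "c x m \<noteq> 1" if "int x = a - 1 \<or> int x = a + l m" for x
  proof
    assume x: "c x m = 1"
    from that show False
    proof
      assume e: "int x = a - 1"
      then have "fits (int x + 1) (c n) m" using in_run l_pos[of m] by auto
      then have "fits (int x) (c n) m"
        using fits_neighbour(2)[OF c(1) c(1) x assms(3) f] by blast
      then show False using in_run e by auto
    next
      assume e: "int x = a + l m"
      then have "fits (int x - 1) (c n) m" using in_run l_pos[of m] by auto
      then have "fits (int x - 1 + 1) (c n) m"
        using fits_neighbour(1)[OF c(1) c(1) assms(3) x, of "int x - 1"] f[of x] by simp
      then show False using in_run e by auto
    qed
  qed
qed

end

section \<open>Powers of the golden ratio and of its conjugate\<close>

notation golden_ratio (\<open>\<phi>\<close>)

definition golden_conj :: real (\<open>\<psi>\<close>) where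
  "\<psi> = 1 - \<phi>"

lemma phi_square: "\<phi> * \<phi> = \<phi> + 1"
  by (simp add: golden_ratio_def field_simps)

lemma phi_bounds: "1 < \<phi>" "\<phi> < 2"
proof -
  have "1 < sqrt 5" by simp
  moreover have "sqrt 5 < 3" by (rule real_less_lsqrt) auto
  ultimately show "1 < \<phi>" "\<phi> < 2" by (auto simp: golden_ratio_def)
qed

lemma psi_square: "\<psi> * \<psi> = \<psi> + 1"
  using phi_square by (simp add: golden_conj_def algebra_simps)

lemma inverse_phi: "inverse \<phi> = \<phi> - 1"
  using phi_square phi_bounds by (intro inverse_unique) (simp add: algebra_simps)

lemma psi_eq: "\<psi> = - inverse \<phi>"
  by (simp add: golden_conj_def inverse_phi)

lemma lucas_eq: "real (lucas n) = \<phi> ^ n + \<psi> ^ n"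
proof (induction n rule: lucas.induct)
  case (3 n)
  have "\<phi> ^ Suc (Suc n) = \<phi> ^ Suc n + \<phi> ^ n" "\<psi> ^ Suc (Suc n) = \<psi> ^ Suc n + \<psi> ^ n"
    using phi_square psi_square by (simp_all add: algebra_simps flip: mult.assoc)
  then show ?case using 3 by simp
qed (simp_all add: golden_conj_def)

lemma lucas_alternating_eq: "(- 1) ^ n * real (lucas n) = inverse \<phi> ^ n + inverse \<psi> ^ n"
proof -
  have "inverse \<psi> = - \<phi>" by (simp add: psi_eq)
  then show ?thesis by (simp add: lucas_eq psi_eq[symmetric] distrib_left flip: power_mult_distrib)
     (simp add: psi_eq)
qed

text \<open>A Horner step that splits off the digit at place 0; it drives the inductions on
  expansions.\<close>

lemma power_sum_shift:
  "(\<Sum>k<Suc n. real (u k) * r ^ Suc k) = (real (u 0) + (\<Sum>k<n. real (u (Suc k)) * r ^ Suc k)) * r"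
  by (simp add: sum.lessThan_Suc_shift sum_distrib_left sum_distrib_right algebra_simps
      del: sum.lessThan_Suc)

section \<open>Ranges of one-sided expansions in powers of \<phi> and of its conjugate\<close>

lemma phi_expansion_bounds:
  assumes "admissible u" "\<forall>k\<ge>n. u k = 0"
  defines "V \<equiv> (\<Sum>k<n. real (u k) * inverse \<phi> ^ Suc k)"
  shows "0 \<le> V" "V < 1" "u 0 = 0 \<Longrightarrow> V < \<phi> - 1"
proof -
  have "0 \<le> V \<and> V < 1 \<and> (u 0 = 0 \<longrightarrow> V < \<phi> - 1)"
    unfolding V_def using assms(1,2)
  proof (induction n arbitrary: u)
    case 0
    then show ?case using phi_bounds by simp
  next
    case (Suc n)
    define W where "W = (\<Sum>k<n. real (u (Suc k)) * inverse \<phi> ^ Suc k)"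
    have W: "0 \<le> W \<and> W < 1 \<and> (u (Suc 0) = 0 \<longrightarrow> W < \<phi> - 1)"
      unfolding W_def by (rule Suc.IH[OF admissible_shift[OF Suc.prems(1)]]) (use Suc.prems(2) in simp)
    have eq: "(\<Sum>k<Suc n. real (u k) * inverse \<phi> ^ Suc k) = (real (u 0) + W) * (\<phi> - 1)"
      unfolding power_sum_shift W_def inverse_phi ..
    consider "u 0 = 0" | "u 0 = 1" "u (Suc 0) = 0"
      using admissible_01[OF Suc.prems(1), of 0] admissible_Suc[OF Suc.prems(1), of 0] by metis
    then show ?case
    proof cases
      case 1
      have "W * (\<phi> - 1) < 1 * (\<phi> - 1)"
        using W phi_bounds by (intro mult_strict_right_mono) auto
      also have "\<dots> < 1" using phi_bounds by simp
      finally have "W * (\<phi> - 1) < 1" .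
      moreover have "0 \<le> W * (\<phi> - 1)" using W phi_bounds by simp
      moreover have "W * (\<phi> - 1) < \<phi> - 1" using W phi_bounds by simp
      ultimately show ?thesis using 1 unfolding eq by simp
    next
      case 2
      have "(1 + W) * (\<phi> - 1) < (1 + (\<phi> - 1)) * (\<phi> - 1)"
        using W 2 phi_bounds by (intro mult_strict_right_mono) auto
      also have "\<dots> = 1" using phi_square by (simp add: algebra_simps)
      finally show ?thesis using 2 W phi_bounds unfolding eq by auto
    qed
  qed
  then show "0 \<le> V" "V < 1" "u 0 = 0 \<Longrightarrow> V < \<phi> - 1" by auto
qed

text \<open>Multiplication by the negative \<psi> reverses order. A leading 0 maps the whole range
  (-1, \<phi> - 1) to (\<phi> - 2, \<phi> - 1); a leading 1 leaves only (\<phi> - 2, \<phi> - 1) for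
  the rest and shifts it before mapping, which gives (-1, \<phi> - 2).\<close>

lemma psi_expansion_bounds:
  assumes "admissible u" "\<forall>k\<ge>n. u k = 0"
  defines "W \<equiv> (\<Sum>k<n. real (u k) * \<psi> ^ Suc k)"
  shows "u 0 = 1 \<Longrightarrow> -1 < W" "u 0 = 1 \<Longrightarrow> W < \<phi> - 2"
    "u 0 = 0 \<Longrightarrow> \<phi> - 2 < W" "W < \<phi> - 1"
proof -
  have "if u 0 = 1 then -1 < W \<and> W < \<phi> - 2 else \<phi> - 2 < W \<and> W < \<phi> - 1"
    unfolding W_def using assms(1,2)
  proof (induction n arbitrary: u)
    case 0
    then show ?case using phi_bounds by simp
  next
    case (Suc n)
    define V where "V = (\<Sum>k<n. real (u (Suc k)) * \<psi> ^ Suc k)"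
    have V: "if u (Suc 0) = 1 then -1 < V \<and> V < \<phi> - 2 else \<phi> - 2 < V \<and> V < \<phi> - 1"
      unfolding V_def by (rule Suc.IH[OF admissible_shift[OF Suc.prems(1)]]) (use Suc.prems(2) in simp)
    have eq: "(\<Sum>k<Suc n. real (u k) * \<psi> ^ Suc k) = (real (u 0) + V) * (1 - \<phi>)"
      unfolding power_sum_shift V_def golden_conj_def ..
    have mono: "a < b \<Longrightarrow> b * (1 - \<phi>) < a * (1 - \<phi>)" for a b
      using phi_bounds by (simp add: mult_strict_right_mono_neg)
    consider "u 0 = 0" | "u 0 = 1" "u (Suc 0) = 0"
      using admissible_01[OF Suc.prems(1), of 0] admissible_Suc[OF Suc.prems(1), of 0] by metis
    then show ?case
    proof cases
      case 1
      have "V < \<phi> - 1" "-1 < V" using V phi_bounds by (auto split: if_splits)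
      from this[THEN mono] show ?thesis
        unfolding eq using 1 phi_square by (simp add: algebra_simps)
    next
      case 2
      have "1 + V < \<phi>" "\<phi> - 1 < 1 + V" using V 2 phi_bounds by auto
      from this[THEN mono] show ?thesis
        unfolding eq using 2 phi_square by (simp add: algebra_simps)
    qed
  qed
  then show "u 0 = 1 \<Longrightarrow> -1 < W" "u 0 = 1 \<Longrightarrow> W < \<phi> - 2"
    "u 0 = 0 \<Longrightarrow> \<phi> - 2 < W" "W < \<phi> - 1"
    using phi_bounds by (auto split: if_splits)
qed

text \<open>For \<open>f = b + a * \<phi>\<close> in \<open>{0..<1}\<close> one step of the greedy algorithm replaces \<open>a\<close> by
  \<open>a + b\<close>, the negated integer part of \<open>a / \<phi>\<close>, so that \<open>2 * \<bar>a\<bar> + of_bool (a < 0)\<close> decreases.\<close>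

lemma greedy_expansion:
  fixes a b :: int
  assumes "0 \<le> b + a * \<phi>" "b + a * \<phi> < 1"
  shows "\<exists>u n. admissible u \<and> (\<forall>k\<ge>n. u k = 0) \<and>
    (\<Sum>k<n. real (u k) * inverse \<phi> ^ Suc k) = b + a * \<phi> \<and>
    (\<Sum>k<n. real (u k) * inverse \<psi> ^ Suc k) = b + a * \<psi> \<and>
    (b + a * \<phi> < \<phi> - 1 \<longrightarrow> u 0 = 0)"
  using assms
proof (induction "nat (2 * \<bar>a\<bar> + of_bool (a < 0))" arbitrary: a b rule: less_induct)
  case less
  show ?case
  proof (cases "a = 0")
    case True
    then have "b = 0" using less.prems by simp
    then show ?thesis using True by (intro exI[of _ "\<lambda>_. 0"] exI[of _ 0]) (simp add: admissible_def)
  next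
    case False
    \<comment> \<open>The greedy digit compares with the first weight,
      \<open>inverse \<phi> = \<phi> - 1\<close>.\<close>
    define d :: nat where "d = (if \<phi> - 1 \<le> b + a * \<phi> then 1 else 0)"
    define a' b' where "a' = a + b" and "b' = a - int d"
    have step: "b' + a' * \<phi> = \<phi> * (b + a * \<phi>) - d" "b' + a' * \<psi> = \<psi> * (b + a * \<psi>) - d"
      using phi_square psi_square by (simp_all add: a'_def b'_def algebra_simps flip: mult.assoc)
    have prod: "\<phi> * (\<phi> - 1) = 1" using phi_square by (simp add: algebra_simps)
    \<comment> \<open>After a digit 1 the new value is below \<open>\<phi> - 1\<close>, which forces
      the next digit to be 0.\<close>
    have lt1: "b' + a' * \<phi> < (if d = 1 then \<phi> - 1 else 1)"
    proof (cases "d = 1")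
      case True
      have "\<phi> * (b + a * \<phi>) < \<phi> * 1"
        using less.prems phi_bounds by (intro mult_strict_left_mono) auto
      then show ?thesis using True unfolding step by simp
    next
      case False
      then have "\<phi> * (b + a * \<phi>) < \<phi> * (\<phi> - 1)"
        using phi_bounds by (intro mult_strict_left_mono) (auto simp: d_def split: if_splits)
      then show ?thesis using False unfolding step prod by (simp add: d_def)
    qed
    have ge0: "0 \<le> b' + a' * \<phi>"
    proof (cases "d = 1")
      case True
      then have "\<phi> * (\<phi> - 1) \<le> \<phi> * (b + a * \<phi>)"
        using phi_bounds by (intro mult_left_mono) (auto simp: d_def split: if_splits)
      then show ?thesis using True unfolding step prod by simp
    next
      case False
      then show ?thesis using less.prems phi_bounds unfolding step by (simp add: d_def split: if_splits)
    qed
    have "real_of_int a' = (b + a * \<phi>) - a * (\<phi> - 1)" by (simp add: a'_def algebra_simps)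
    then have a': "- (a * (\<phi> - 1)) \<le> a'" "a' < 1 - a * (\<phi> - 1)" using less.prems by auto
    have "nat (2 * \<bar>a'\<bar> + of_bool (a' < 0)) < nat (2 * \<bar>a\<bar> + of_bool (a < 0))"
    proof (cases "a > 0")
      case True
      then have "0 < a * (\<phi> - 1)" "a * (\<phi> - 1) < real_of_int a" using phi_bounds by auto
      then have "- a < a'" "a' < 1" using a' by linarith+
      then show ?thesis using True by auto
    next
      case neg: False
      then have "0 < (- a) * (\<phi> - 1)" "(- a) * (\<phi> - 1) < real_of_int (- a)"
        using phi_bounds False by (auto simp: mult_less_0_iff)
      \<comment> \<open>Here \<open>a' = - a\<close> can occur; the sign term of the measure then
        still makes it drop.\<close>
      then have "0 < a'" "a' < 1 - a" using a' by linarith+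
      then show ?thesis using neg False by auto
    qed
    moreover have "b' + a' * \<phi> < 1" using lt1 phi_bounds by (auto split: if_splits)
    ultimately obtain u n where u: "admissible u" "\<forall>k\<ge>n. u k = 0"
      "(\<Sum>k<n. real (u k) * inverse \<phi> ^ Suc k) = b' + a' * \<phi>"
      "(\<Sum>k<n. real (u k) * inverse \<psi> ^ Suc k) = b' + a' * \<psi>"
      "b' + a' * \<phi> < \<phi> - 1 \<longrightarrow> u 0 = 0"
      using less.hyps[of a' b'] ge0 by blast
    have shift: "(\<Sum>k<Suc n. real (case_nat d u k) * r ^ Suc k) =
        (d + (\<Sum>k<n. real (u k) * r ^ Suc k)) * r" for r :: real
      unfolding power_sum_shift by simp
    have nz: "\<phi> \<noteq> 0" "\<psi> \<noteq> 0" using phi_bounds by (auto simp: golden_conj_def)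
    show ?thesis
    proof (intro exI[of _ "case_nat d u"] exI[of _ "Suc n"] conjI)
      show "admissible (case_nat d u)"
        using u lt1 by (intro admissible_case_nat) (auto simp: d_def)
      show "\<forall>k\<ge>Suc n. case_nat d u k = 0" using u(2) by (auto split: nat.splits)
      show "(\<Sum>k<Suc n. real (case_nat d u k) * inverse \<phi> ^ Suc k) = b + a * \<phi>"
        unfolding shift u(3) step using nz by simp
      show "(\<Sum>k<Suc n. real (case_nat d u k) * inverse \<psi> ^ Suc k) = b + a * \<psi>"
        unfolding shift u(4) step using nz by simp
      show "b + a * \<phi> < \<phi> - 1 \<longrightarrow> case_nat d u 0 = 0" by (auto simp: d_def)
    qed
  qed
qed

text \<open>Both \<phi> and \<psi> satisfy x * x = x + 1, so one and the same reduction to integer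
  coordinates serves a sum and its conjugate.\<close>

lemma phi_power_sum_integral:
  "\<exists>(a :: int) (b :: int). (\<Sum>k<n. real (u k) * \<phi> ^ Suc k) = b + a * \<phi> \<and>
    (\<Sum>k<n. real (u k) * \<psi> ^ Suc k) = b + a * \<psi>"
proof (induction n)
  case 0
  show ?case by (intro exI[of _ 0]) simp
next
  case (Suc n)
  then obtain a b :: int where ab: "(\<Sum>k<n. real (u k) * \<phi> ^ Suc k) = b + a * \<phi>"
    "(\<Sum>k<n. real (u k) * \<psi> ^ Suc k) = b + a * \<psi>" by blast
  have "\<exists>(a :: int) (b :: int). \<phi> ^ k = b + a * \<phi> \<and> \<psi> ^ k = b + a * \<psi>" for k
  proof (induction k)
    case 0
    show ?case by (intro exI[of _ 0] exI[of _ 1]) simp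
  next
    case (Suc k)
    then obtain a b :: int where "\<phi> ^ k = b + a * \<phi>" "\<psi> ^ k = b + a * \<psi>" by blast
    then show ?case using phi_square psi_square
      by (intro exI[of _ "a + b"] exI[of _ a]) (simp add: algebra_simps flip: mult.assoc)
  qed
  then obtain c d :: int where "\<phi> ^ Suc n = d + c * \<phi>" "\<psi> ^ Suc n = d + c * \<psi>" by blast
  then show ?case using ab
    by (intro exI[of _ "a + int (u n) * c"] exI[of _ "b + int (u n) * d"])
      (simp add: algebra_simps del: power_Suc)
qed

section \<open>Expansions of natural numbers\<close>

lemma powi_split:
  fixes x :: real
  shows "x powi (1 + int k) = x ^ Suc k" "x powi (- 1 - int k) = inverse x ^ Suc k"
proof -
  show "x powi (1 + int k) = x ^ Suc k" using power_int_of_nat[of x "Suc k"] by simp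
  have "- 1 - int k = - int (Suc k)" by simp
  then show "x powi (- 1 - int k) = inverse x ^ Suc k"
    by (simp only: power_int_minus power_int_of_nat power_inverse)
qed

lemma two_sided_sum:
  fixes c :: "int \<Rightarrow> nat" and h :: "int \<Rightarrow> real"
  assumes "\<forall>k\<ge>n. c (1 + int k) = 0" "\<forall>k\<ge>m. c (- 1 - int k) = 0"
  shows "finite {i. c i \<noteq> 0}"
    and "(\<Sum>i | c i \<noteq> 0. real (c i) * h i) =
      (\<Sum>k<n. real (c (1 + int k)) * h (1 + int k)) + real (c 0) * h 0 +
      (\<Sum>k<m. real (c (- 1 - int k)) * h (- 1 - int k))"
proof -
  define A B where "A = (\<lambda>k. 1 + int k) ` {..<n}" and "B = (\<lambda>k. - 1 - int k) ` {..<m}"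
  have sub: "{i. c i \<noteq> 0} \<subseteq> A \<union> ({0} \<union> B)"
  proof
    fix i assume "i \<in> {i. c i \<noteq> 0}"
    then have i: "c i \<noteq> 0" by simp
    consider "i > 0" | "i = 0" | "i < 0" by linarith
    then show "i \<in> A \<union> ({0} \<union> B)"
    proof cases
      case 1
      then have "i = 1 + int (nat (i - 1))" by simp
      moreover have "nat (i - 1) < n" using assms(1)[rule_format, of "nat (i - 1)"] i 1 by (auto intro: leI)
      ultimately show ?thesis unfolding A_def by blast
    next
      case 3
      then have "i = - 1 - int (nat (- 1 - i))" by simp
      moreover have "nat (- 1 - i) < m" using assms(2)[rule_format, of "nat (- 1 - i)"] i 3 by (auto intro: leI)
      ultimately show ?thesis unfolding B_def by blast
    qed simp
  qed
  have fin: "finite (A \<union> ({0} \<union> B))" unfolding A_def B_def by simp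
  show "finite {i. c i \<noteq> 0}" using sub fin by (rule finite_subset)
  have "(\<Sum>i | c i \<noteq> 0. real (c i) * h i) = (\<Sum>i\<in>A \<union> ({0} \<union> B). real (c i) * h i)"
    using sub fin by (intro sum.mono_neutral_left) auto
  also have "\<dots> = (\<Sum>i\<in>A. real (c i) * h i) + (\<Sum>i\<in>{0} \<union> B. real (c i) * h i)"
    by (rule sum.union_disjoint) (auto simp: A_def B_def)
  also have "(\<Sum>i\<in>{0} \<union> B. real (c i) * h i) = real (c 0) * h 0 + (\<Sum>i\<in>B. real (c i) * h i)"
    by (subst sum.union_disjoint) (auto simp: B_def)
  also have "(\<Sum>i\<in>A. real (c i) * h i) = (\<Sum>k<n. real (c (1 + int k)) * h (1 + int k))"
    unfolding A_def by (subst sum.reindex) (auto simp: inj_on_def)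
  also have "(\<Sum>i\<in>B. real (c i) * h i) = (\<Sum>k<m. real (c (- 1 - int k)) * h (- 1 - int k))"
    unfolding B_def by (subst sum.reindex) (auto simp: inj_on_def)
  finally show "(\<Sum>i | c i \<noteq> 0. real (c i) * h i) =
      (\<Sum>k<n. real (c (1 + int k)) * h (1 + int k)) + real (c 0) * h 0 +
      (\<Sum>k<m. real (c (- 1 - int k)) * h (- 1 - int k))" by simp
qed

lemma finite_support_bound:
  fixes u :: "nat \<Rightarrow> nat"
  assumes "finite {k. u k \<noteq> 0}"
  obtains n where "\<forall>k\<ge>n. u k = 0"
proof -
  obtain n where "\<forall>k\<in>{k. u k \<noteq> 0}. k < n"
    using assms finite_nat_set_iff_bounded by blast
  then have "\<forall>k\<ge>n. u k = 0" using leD by blast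
  then show thesis by (rule that)
qed

lemma admissible_compose:
  fixes c :: "int \<Rightarrow> nat"
  assumes "finite {i. c i \<noteq> 0}" "\<And>i. c i \<in> {0, 1}" "inj g"
    "\<And>k. c (g k) = 1 \<Longrightarrow> c (g (Suc k)) \<noteq> 1"
  shows "admissible (\<lambda>k. c (g k))"
proof -
  have "finite (g -` {i. c i \<noteq> 0})" using assms(1,3) by (rule finite_vimageI)
  moreover have "c (g (Suc k)) = 0" if "c (g k) = 1" for k
    using assms(2)[of "g (Suc k)"] assms(4)[OF that] by auto
  ultimately show ?thesis using assms(2) by (simp add: admissible_def vimage_def)
qed

section \<open>Uniqueness of expansions in base \<phi>\<close>

text \<open>Dividing by \<open>\<phi> powi M\<close> turns the digits below \<open>M\<close> into a
  one-sided expansion, whose value is less than 1.\<close>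

lemma lower_sum_less:
  fixes c :: "int \<Rightarrow> nat"
  assumes "finite {i. c i \<noteq> 0}" "\<And>i. c i \<in> {0, 1}" "\<And>i. \<not> (c (i + 1) = 1 \<and> c i = 1)"
  shows "(\<Sum>i | c i \<noteq> 0 \<and> i < M. real (c i) * \<phi> powi i) < \<phi> powi M"
proof -
  define u where "u = (\<lambda>k. c (M - 1 - int k))"
  have u: "admissible u"
    unfolding u_def using assms(1,2)
  proof (rule admissible_compose)
    show "inj (\<lambda>k. M - 1 - int k)" by (simp add: inj_def)
    show "c (M - 1 - int (Suc k)) \<noteq> 1" if "c (M - 1 - int k) = 1" for k
      using assms(3)[of "M - 1 - int (Suc k)"] that by (simp add: algebra_simps)
  qed
  then obtain n where n: "\<forall>k\<ge>n. u k = 0"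
    using finite_support_bound[of u] unfolding admissible_def by auto
  have "{i. c i \<noteq> 0 \<and> i < M} \<subseteq> (\<lambda>k. M - 1 - int k) ` {..<n}"
  proof
    fix i assume "i \<in> {i. c i \<noteq> 0 \<and> i < M}"
    then have i: "i = M - 1 - int (nat (M - 1 - i))" "c i \<noteq> 0" by auto
    moreover have "nat (M - 1 - i) < n"
      using n[rule_format, of "nat (M - 1 - i)"] i unfolding u_def by (metis leI)
    ultimately show "i \<in> (\<lambda>k. M - 1 - int k) ` {..<n}" by blast
  qed
  then have "(\<Sum>i | c i \<noteq> 0 \<and> i < M. real (c i) * \<phi> powi i) =
      (\<Sum>i\<in>(\<lambda>k. M - 1 - int k) ` {..<n}. real (c i) * \<phi> powi i)"
    by (intro sum.mono_neutral_left) auto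
  also have "\<dots> = (\<Sum>k<n. real (u k) * \<phi> powi (M + (- 1 - int k)))"
    unfolding u_def by (subst sum.reindex) (auto simp: inj_on_def algebra_simps)
  also have "\<dots> = \<phi> powi M * (\<Sum>k<n. real (u k) * inverse \<phi> ^ Suc k)"
    using phi_bounds by (simp add: power_int_add powi_split sum_distrib_left mult.left_commute)
  also have "\<dots> < \<phi> powi M * 1"
    using phi_bounds phi_expansion_bounds(2)[OF u n]
    by (intro mult_strict_left_mono zero_less_power_int) auto
  finally show ?thesis by simp
qed

text \<open>At the highest position \<open>M\<close> where the strings differ, the larger digit
  contributes \<open>\<phi> powi M\<close>, which the lower digits of the other string cannot make
  up. The common value may be any real number, so that strings with a pair removed are covered
  too.\<close>

lemma expansion_unique:
  fixes c d :: "int \<Rightarrow> nat"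
  assumes c: "finite {i. c i \<noteq> 0}" "\<And>i. c i \<in> {0, 1}" "\<And>i. \<not> (c (i + 1) = 1 \<and> c i = 1)"
    and d: "finite {i. d i \<noteq> 0}" "\<And>i. d i \<in> {0, 1}" "\<And>i. \<not> (d (i + 1) = 1 \<and> d i = 1)"
    and eq: "(\<Sum>i | c i \<noteq> 0. real (c i) * \<phi> powi i) = (\<Sum>i | d i \<noteq> 0. real (d i) * \<phi> powi i)"
  shows "c = d"
proof (rule ccontr)
  define M where "M = Max {i. c i \<noteq> d i}"
  have fin: "finite {i. c i \<noteq> d i}"
    by (rule finite_subset[of _ "{i. c i \<noteq> 0} \<union> {i. d i \<noteq> 0}"]) (use c(1) d(1) in auto)
  assume "c \<noteq> d"
  then have "M \<in> {i. c i \<noteq> d i}" unfolding M_def using fin by (intro Max_in) auto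
  then have M: "c M \<noteq> d M" by simp
  have above: "c i = d i" if "M < i" for i
    using Max_ge[OF fin, of i] that by (fold M_def) force
  have split: "(\<Sum>i | e i \<noteq> 0. real (e i) * \<phi> powi i) =
      (\<Sum>i | e i \<noteq> 0 \<and> M < i. real (e i) * \<phi> powi i) + real (e M) * \<phi> powi M +
      (\<Sum>i | e i \<noteq> 0 \<and> i < M. real (e i) * \<phi> powi i)"
    if "finite {i. e i \<noteq> 0}" for e :: "int \<Rightarrow> nat"
  proof -
    have "(\<Sum>i | e i \<noteq> 0. real (e i) * \<phi> powi i) =
        (\<Sum>i\<in>{i. e i \<noteq> 0 \<and> M < i} \<union> ({M} \<union> {i. e i \<noteq> 0 \<and> i < M}). real (e i) * \<phi> powi i)"
      using that by (intro sum.mono_neutral_left) auto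
    also have "\<dots> = (\<Sum>i | e i \<noteq> 0 \<and> M < i. real (e i) * \<phi> powi i) +
        (\<Sum>i\<in>{M} \<union> {i. e i \<noteq> 0 \<and> i < M}. real (e i) * \<phi> powi i)"
      using that by (intro sum.union_disjoint) auto
    also have "(\<Sum>i\<in>{M} \<union> {i. e i \<noteq> 0 \<and> i < M}. real (e i) * \<phi> powi i) =
        real (e M) * \<phi> powi M + (\<Sum>i | e i \<noteq> 0 \<and> i < M. real (e i) * \<phi> powi i)"
      using that by (subst sum.union_disjoint) auto
    finally show ?thesis by simp
  qed
  have "(\<Sum>i | c i \<noteq> 0 \<and> M < i. real (c i) * \<phi> powi i) =
      (\<Sum>i | d i \<noteq> 0 \<and> M < i. real (d i) * \<phi> powi i)"
    using above by (intro sum.cong) auto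
  with eq have eq': "real (c M) * \<phi> powi M + (\<Sum>i | c i \<noteq> 0 \<and> i < M. real (c i) * \<phi> powi i) =
      real (d M) * \<phi> powi M + (\<Sum>i | d i \<noteq> 0 \<and> i < M. real (d i) * \<phi> powi i)"
    unfolding split[OF c(1)] split[OF d(1)] by simp
  have nonneg: "0 \<le> (\<Sum>i | e i \<noteq> 0 \<and> i < M. real (e i) * \<phi> powi i)" for e :: "int \<Rightarrow> nat"
    using phi_bounds by (intro sum_nonneg mult_nonneg_nonneg zero_le_power_int) auto
  have "(c M = 1 \<and> d M = 0) \<or> (c M = 0 \<and> d M = 1)" using M c(2)[of M] d(2)[of M] by auto
  then show False
    using eq' nonneg[of c] nonneg[of d] lower_sum_less[OF c, of M] lower_sum_less[OF d, of M] by auto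
qed

lemma is_bergman_unique: "is_bergman c N \<Longrightarrow> is_bergman d N \<Longrightarrow> c = d"
  unfolding is_bergman_def represents_def by (intro expansion_unique) auto

text \<open>Erasing the pair 11 at positions 1 and 0 leaves an expansion of N - 1 - \<phi> without
  adjacent ones, to which \<open>expansion_unique\<close> applies.\<close>

lemma is_canonical11_unique:
  assumes "is_canonical11 c N" "is_canonical11 d N"
  shows "c = d"
proof -
  define drop where "drop e = e(0 := 0, 1 := 0)" for e :: "int \<Rightarrow> nat"
  have drop: "finite {i. drop e i \<noteq> 0}" "\<And>i. drop e i \<in> {0, 1}"
      "\<And>i. \<not> (drop e (i + 1) = 1 \<and> drop e i = 1)"
      "(\<Sum>i | drop e i \<noteq> 0. real (drop e i) * \<phi> powi i) = real N - 1 - \<phi>"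
    if e: "is_canonical11 e N" for e
  proof -
    have e': "represents e N" "e 1 = 1" "e 0 = 1" "\<forall>i. i \<noteq> 0 \<longrightarrow> \<not> (e (i + 1) = 1 \<and> e i = 1)"
      using e by (auto simp: is_canonical11_def)
    have S: "{i. e i \<noteq> 0} = insert 0 (insert 1 {i. drop e i \<noteq> 0})"
      using e' by (auto simp: drop_def)
    have "finite {i. e i \<noteq> 0}" using e' by (simp add: represents_def)
    then show fin: "finite {i. drop e i \<noteq> 0}" by (simp only: S finite_insert)
    show "drop e i \<in> {0, 1}" for i using e' by (simp add: drop_def represents_def)
    show "\<not> (drop e (i + 1) = 1 \<and> drop e i = 1)" for i
      using e'(4)[rule_format, of i] by (simp add: drop_def)
    have "real N = (\<Sum>i | e i \<noteq> 0. real (e i) * \<phi> powi i)"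
      using e' by (simp add: represents_def)
    also have "\<dots> = real (e 0) * \<phi> powi 0 + (real (e 1) * \<phi> powi 1 +
        (\<Sum>i | drop e i \<noteq> 0. real (e i) * \<phi> powi i))"
      unfolding S using fin by (subst sum.insert, simp, simp add: drop_def)+ simp
    also have "(\<Sum>i | drop e i \<noteq> 0. real (e i) * \<phi> powi i) =
        (\<Sum>i | drop e i \<noteq> 0. real (drop e i) * \<phi> powi i)"
      by (intro sum.cong) (simp_all add: drop_def split: if_splits)
    finally show "(\<Sum>i | drop e i \<noteq> 0. real (drop e i) * \<phi> powi i) = real N - 1 - \<phi>"
      using e' by simp
  qed
  have "drop c = drop d"
    using drop[OF assms(1)] drop[OF assms(2)] by (intro expansion_unique) simp_all
  then have "drop c i = drop d i" for i by simp
  then have "c i = d i" if "i \<noteq> 0" "i \<noteq> 1" for i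
    using that by (metis drop_def fun_upd_apply)
  moreover have "c 0 = d 0" "c 1 = d 1" using assms by (simp_all add: is_canonical11_def)
  ultimately show ?thesis by (intro ext) metis
qed

section \<open>The two Lucas numerations\<close>

lemma lucas_pos: "0 < lucas n"
  by (induction n rule: lucas.induct) auto

lemma lucas_ge: "n \<le> lucas n"
proof (induction n rule: lucas.induct)
  case (3 n)
  then show ?case using lucas_pos[of n] by simp
qed auto

text \<open>Place \<open>k\<close> carries the digit of index \<open>k + 1\<close>. Every interval
  starts at 0, and the translate for digit 1 always lies to the right.\<close>

interpretation upper: nested_numeration "\<lambda>k. int (lucas (Suc k))" "\<lambda>_. 0" "\<lambda>k. int (lucas k)"
  by unfold_locales (auto simp: lucas_pos)

text \<open>Left ends of the intervals for the weights \<open>(- 1) ^ k * int (lucas k)\<close>: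
  positive weights extend an interval to the right, negative ones to the left. The initial intervals
  {-2, -1} and {-1} hold the possible corrections when the digit of index 0 is 1 or 0.\<close>

fun lower_start :: "nat \<Rightarrow> int" where
  "lower_start 0 = - 2"
| "lower_start (Suc 0) = - 1"
| "lower_start (Suc (Suc k)) =
     (if even k then lower_start (Suc k) else lower_start k - int (lucas k))"

text \<open>Consecutive intervals share their right end for even \<open>k\<close> and their left end
  for odd \<open>k\<close>; a shift by the signed length of \<open>D k\<close> therefore puts it
  right beside \<open>D (k + 1)\<close>.\<close>

lemma lower_start_step:
  "if even k then lower_start k + int (lucas k) = lower_start (Suc k) + int (lucas (Suc k))
   else lower_start k = lower_start (Suc k)"
  by (cases k rule: lower_start.cases) simp_all

interpretation lower: nested_numeration "\<lambda>k. (- 1) ^ k * int (lucas k)" lower_start "\<lambda>k. int (lucas k)"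
proof
  fix k
  show "(lower_start (Suc (Suc k)) = lower_start (Suc k) \<and>
         (- 1) ^ k * int (lucas k) + lower_start k = lower_start (Suc k) + int (lucas (Suc k))) \<or>
        (lower_start (Suc (Suc k)) = (- 1) ^ k * int (lucas k) + lower_start k \<and>
         (- 1) ^ k * int (lucas k) + lower_start k + int (lucas k) = lower_start (Suc k))"
    using lower_start_step[of k] by (cases "even k") auto
qed (auto simp: lucas_pos)

lemma upper_tail_eq:
  assumes "\<forall>k\<ge>n. u k = 0"
  shows "real_of_int (upper.tail 0 u) =
    (\<Sum>k<n. real (u k) * \<phi> ^ Suc k) + (\<Sum>k<n. real (u k) * \<psi> ^ Suc k)"
proof -
  have "real_of_int (upper.tail 0 u) = (\<Sum>k<n. real (u k) * real (lucas (Suc k)))"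
    using assms by (subst upper.tail_0_eq[of n]) simp_all
  then show ?thesis by (simp only: lucas_eq distrib_left sum.distrib)
qed

text \<open>The trace of an integer power of \<open>\<phi>\<close> is, up to sign, a Lucas number.  So the digits of
  positive index nearly give an expansion of \<open>N - 1\<close> in Lucas numbers, and the others one
  in Lucas numbers with alternating signs, because the conjugate of \<open>N\<close> is \<open>N\<close>.\<close>

definition good :: "(int \<Rightarrow> nat) \<Rightarrow> nat \<Rightarrow> bool" where
  "good c N \<longleftrightarrow> represents c N \<and> (\<forall>i. i \<noteq> 0 \<longrightarrow> \<not> (c (i + 1) = 1 \<and> c i = 1)) \<and>
     (\<Sum>i | c i \<noteq> 0. real (c i) * \<psi> powi i) = real N \<and>
     int N - 1 = upper.tail 0 (\<lambda>k. c (1 + int k)) + of_bool (c 1 = 1 \<and> c 0 = 1)"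

text \<open>The string is cut between indices 1 and 0, the only place where a pair 11 is allowed, so
  neither half contains one.\<close>

lemma
  assumes "represents c N" "\<forall>i. i \<noteq> 0 \<longrightarrow> \<not> (c (i + 1) = 1 \<and> c i = 1)"
  shows admissible_upper: "admissible (\<lambda>k. c (1 + int k))"
    and admissible_lower: "admissible (\<lambda>k. c (- int k))"
proof -
  have c: "finite {i. c i \<noteq> 0}" "\<And>i. c i \<in> {0, 1}" using assms(1) by (auto simp: represents_def)
  show "admissible (\<lambda>k. c (1 + int k))"
  proof (rule admissible_compose[OF c])
    show "c (1 + int (Suc k)) \<noteq> 1" if "c (1 + int k) = 1" for k
      using assms(2)[rule_format, of "1 + int k"] that by (simp add: algebra_simps)
  qed (simp add: inj_def)
  show "admissible (\<lambda>k. c (- int k))"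
  proof (rule admissible_compose[OF c])
    show "c (- int (Suc k)) \<noteq> 1" if "c (- int k) = 1" for k
      using assms(2)[rule_format, of "- int (Suc k)"] that by simp
  qed (simp add: inj_def)
qed

lemma represents_split:
  assumes "represents c N" "\<forall>i. i \<noteq> 0 \<longrightarrow> \<not> (c (i + 1) = 1 \<and> c i = 1)"
  obtains n where "\<forall>k\<ge>n. c (1 + int k) = 0" "\<forall>k\<ge>n. c (- 1 - int k) = 0"
    "real N = (\<Sum>k<n. real (c (1 + int k)) * \<phi> ^ Suc k) + real (c 0) +
      (\<Sum>k<n. real (c (- 1 - int k)) * inverse \<phi> ^ Suc k)"
proof -
  have adm: "admissible (\<lambda>k. c (1 + int k))" "admissible (\<lambda>k. c (- 1 - int k))"
    using admissible_upper[OF assms] admissible_shift[OF admissible_lower[OF assms]]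
    by (simp_all add: algebra_simps)
  obtain p where p: "\<forall>k\<ge>p. c (1 + int k) = 0"
    using adm(1) finite_support_bound[of "\<lambda>k. c (1 + int k)"] unfolding admissible_def by auto
  obtain q where q: "\<forall>k\<ge>q. c (- 1 - int k) = 0"
    using adm(2) finite_support_bound[of "\<lambda>k. c (- 1 - int k)"] unfolding admissible_def by auto
  define n where "n = max p q"
  have n: "\<forall>k\<ge>n. c (1 + int k) = 0" "\<forall>k\<ge>n. c (- 1 - int k) = 0"
    using p q by (auto simp: n_def)
  show thesis
    using n
  proof (rule that)
    show "real N = (\<Sum>k<n. real (c (1 + int k)) * \<phi> ^ Suc k) + real (c 0) +
      (\<Sum>k<n. real (c (- 1 - int k)) * inverse \<phi> ^ Suc k)"
      using assms(1) two_sided_sum(2)[of n c n "\<lambda>i. \<phi> powi i", OF n]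
      by (simp only: represents_def powi_split power_int_0_right mult_1_right)
  qed
qed

lemma good_upper_fits:
  assumes "good c N"
  shows "upper.fits (int N - 1) (\<lambda>k. c (1 + int k)) 0"
  using assms by (auto simp: good_def upper.fits_def upper.D_def)

text \<open>Adding the expansion of \<open>N\<close> to its conjugate shows that the two tails sum
  to \<open>2 * N\<close>; the digit of index 0 counts twice, in agreement with L_0 = 2. Eliminating
  the upper tail leaves the remainder -1, or -2 for the pair 11.\<close>

lemma good_lower_fits:
  assumes "good c N"
  shows "lower.fits (int N) (\<lambda>k. c (- int k)) 0"
proof -
  have c: "represents c N" "\<forall>i. i \<noteq> 0 \<longrightarrow> \<not> (c (i + 1) = 1 \<and> c i = 1)"
    using assms by (auto simp: good_def)
  obtain n where n: "\<forall>k\<ge>n. c (1 + int k) = 0" "\<forall>k\<ge>n. c (- 1 - int k) = 0"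
    and N: "real N = (\<Sum>k<n. real (c (1 + int k)) * \<phi> ^ Suc k) + real (c 0) +
      (\<Sum>k<n. real (c (- 1 - int k)) * inverse \<phi> ^ Suc k)"
    using c by (rule represents_split) blast
  have "real N = (\<Sum>i | c i \<noteq> 0. real (c i) * \<psi> powi i)" using assms by (simp add: good_def)
  also have "\<dots> = (\<Sum>k<n. real (c (1 + int k)) * \<psi> ^ Suc k) + real (c 0) +
      (\<Sum>k<n. real (c (- 1 - int k)) * inverse \<psi> ^ Suc k)"
    using two_sided_sum(2)[of n c n "\<lambda>i. \<psi> powi i", OF n]
    by (simp only: powi_split power_int_0_right mult_1_right)
  finally have N': "real N = \<dots>" .
  have "c (- int k) = 0" if "Suc n \<le> k" for k
    using n(2)[rule_format, of "k - 1"] that by (cases k) (simp_all add: algebra_simps)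
  then have "real_of_int (lower.tail 0 (\<lambda>k. c (- int k))) =
      (\<Sum>k<Suc n. real (c (- int k)) * ((- 1) ^ k * real (lucas k)))"
    by (subst lower.tail_0_eq[of "Suc n"]) auto
  also have "\<dots> = 2 * real (c 0) + (\<Sum>k<n. real (c (- 1 - int k)) * inverse \<phi> ^ Suc k) +
      (\<Sum>k<n. real (c (- 1 - int k)) * inverse \<psi> ^ Suc k)"
    unfolding lucas_alternating_eq
    by (simp add: sum.lessThan_Suc_shift distrib_left sum.distrib del: sum.lessThan_Suc)
  also have "\<dots> = 2 * real N - real_of_int (upper.tail 0 (\<lambda>k. c (1 + int k)))"
    unfolding upper_tail_eq[OF n(1)] using N N' by simp
  also have "\<dots> = real_of_int (2 * int N - upper.tail 0 (\<lambda>k. c (1 + int k)))" by simp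
  finally have "lower.tail 0 (\<lambda>k. c (- int k)) = 2 * int N - upper.tail 0 (\<lambda>k. c (1 + int k))"
    by (simp only: of_int_eq_iff)
  moreover have "int N - 1 = upper.tail 0 (\<lambda>k. c (1 + int k)) + of_bool (c 1 = 1 \<and> c 0 = 1)"
    using assms by (simp add: good_def)
  ultimately show ?thesis
    by (cases "c 1 = 1"; cases "c 0 = 1") (simp_all add: lower.fits_def lower.D_def)
qed

section \<open>Existence of good strings and their agreement with \<gamma>(N)\<close>

text \<open>N - 1 minus the upper tail equals the part with negative indices minus the conjugate of
  the part with positive indices. The range bounds place this integer strictly between 0 and
  2.\<close>

lemma canonical11_upper_tail:
  assumes "is_canonical11 c N"
  shows "int N - 1 = upper.tail 0 (\<lambda>k. c (1 + int k)) + 1"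
proof -
  have c: "represents c N" "\<forall>i. i \<noteq> 0 \<longrightarrow> \<not> (c (i + 1) = 1 \<and> c i = 1)" "c 1 = 1" "c 0 = 1"
    using assms by (auto simp: is_canonical11_def)
  obtain n where n: "\<forall>k\<ge>n. c (1 + int k) = 0" "\<forall>k\<ge>n. c (- 1 - int k) = 0"
    and N: "real N = (\<Sum>k<n. real (c (1 + int k)) * \<phi> ^ Suc k) + real (c 0) +
      (\<Sum>k<n. real (c (- 1 - int k)) * inverse \<phi> ^ Suc k)"
    using c(1,2) by (rule represents_split) blast
  have adm: "admissible (\<lambda>k. c (1 + int k))" "admissible (\<lambda>k. c (- 1 - int k))"
    using admissible_upper[OF c(1,2)] admissible_shift[OF admissible_lower[OF c(1,2)]]
    by (simp_all add: algebra_simps)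
  have "c (- 1) = 0" using admissible_Suc[OF admissible_lower[OF c(1,2)], of 0] c(4) by simp
  then have f: "0 \<le> (\<Sum>k<n. real (c (- 1 - int k)) * inverse \<phi> ^ Suc k)"
      "(\<Sum>k<n. real (c (- 1 - int k)) * inverse \<phi> ^ Suc k) < \<phi> - 1"
    using phi_expansion_bounds(1,3)[OF adm(2) n(2)] by simp_all
  have z: "-1 < (\<Sum>k<n. real (c (1 + int k)) * \<psi> ^ Suc k)"
      "(\<Sum>k<n. real (c (1 + int k)) * \<psi> ^ Suc k) < \<phi> - 2"
    using psi_expansion_bounds(1,2)[OF adm(1) n(1)] c(3) by simp_all
  have "0 < real N - 1 - real_of_int (upper.tail 0 (\<lambda>k. c (1 + int k)))"
      "real N - 1 - real_of_int (upper.tail 0 (\<lambda>k. c (1 + int k))) < 2"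
    unfolding upper_tail_eq[OF n(1)] N c(4) using f z phi_bounds by simp_all
  then have "0 < int N - 1 - upper.tail 0 (\<lambda>k. c (1 + int k))"
      "int N - 1 - upper.tail 0 (\<lambda>k. c (1 + int k)) < 2" by linarith+
  then show ?thesis by simp
qed

text \<open>The digits of positive index are read off from N - 1 in the upper numeration; a digit at
  0 is then chosen so that the rest lies in [0, 1) and can be expanded greedily.\<close>

lemma good_exists:
  assumes "1 \<le> N"
  shows "\<exists>c. good c N"
proof -
  have "int N - 1 \<in> upper.D (Suc N)"
    using assms lucas_ge[of "Suc N"] unfolding upper.D_def by auto
  then obtain u where u: "admissible u" "\<forall>k\<ge>N. u k = 0" "upper.fits (int N - 1) u 0"
    using upper.fits_exists by blast
  define r where "r = int N - 1 - upper.tail 0 u"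
  have r: "r = 0 \<or> u 0 = 1 \<and> r = 1"
    using u(3) by (auto simp: upper.fits_def upper.D_def r_def split: if_splits)
  define z z' where "z = (\<Sum>k<N. real (u k) * \<phi> ^ Suc k)" and "z' = (\<Sum>k<N. real (u k) * \<psi> ^ Suc k)"
  have tail: "real N - 1 - real_of_int r = z + z'"
    using upper_tail_eq[OF u(2)] by (simp add: r_def z_def z'_def)
  obtain a b :: int where ab: "z = b + a * \<phi>" "z' = b + a * \<psi>"
    unfolding z_def z'_def using phi_power_sum_integral by blast
  \<comment> \<open>The rest before subtracting \<open>d\<close> is \<open>z' + 1 + r\<close>. If
    \<open>c 1 = 1\<close>, the slack \<open>r\<close> is the digit; otherwise \<open>r = 0\<close>,
    and the digit is 1 exactly when the rest reaches 1. In either case \<open>d = 1\<close> leaves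
    less than \<open>\<phi> - 1\<close>, hence a 0 at index -1.\<close>
  define d :: nat where "d = (if u 0 = 1 then nat r else of_bool (0 \<le> z'))"
  have z': "u 0 = 1 \<Longrightarrow> -1 < z'" "u 0 = 1 \<Longrightarrow> z' < \<phi> - 2" "u 0 = 0 \<Longrightarrow> \<phi> - 2 < z'" "z' < \<phi> - 1"
    using psi_expansion_bounds[OF u(1,2)] by (simp_all add: z'_def)
  define b' where "b' = int N - int d - b"
  have conj: "b' + of_int (- a) * \<phi> = real N - z - d" "b' + of_int (- a) * \<psi> = real N - z' - d"
    unfolding ab b'_def by simp_all
  have rest: "real N - z - d = z' + 1 + r - d" using tail by simp
  have "0 \<le> real N - z - d \<and> real N - z - d < 1 \<and> (d = 1 \<longrightarrow> real N - z - d < \<phi> - 1)"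
  proof (cases "u 0 = 1")
    case True
    then show ?thesis using r z' phi_bounds unfolding rest by (auto simp: d_def)
  next
    case False
    then have "u 0 = 0" using admissible_01[OF u(1), of 0] by simp
    then show ?thesis using False r z' phi_bounds unfolding rest by (auto simp: d_def)
  qed
  then have f: "0 \<le> real N - z - d" "real N - z - d < 1" "d = 1 \<Longrightarrow> real N - z - d < \<phi> - 1" by auto
  obtain v m where v: "admissible v" "\<forall>k\<ge>m. v k = 0"
      "(\<Sum>k<m. real (v k) * inverse \<phi> ^ Suc k) = real N - z - d"
      "(\<Sum>k<m. real (v k) * inverse \<psi> ^ Suc k) = real N - z' - d"
      "real N - z - d < \<phi> - 1 \<longrightarrow> v 0 = 0"
    using greedy_expansion[of b' "- a"] f unfolding conj by blast
  define c where "c i = (if i > 0 then u (nat (i - 1)) else if i = 0 then d else v (nat (- 1 - i)))" for i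
  have c: "c (1 + int k) = u k" "c (- 1 - int k) = v k" "c 0 = d" for k by (simp_all add: c_def)
  have split: "(\<Sum>i | c i \<noteq> 0. real (c i) * h i) =
      (\<Sum>k<N. real (u k) * h (1 + int k)) + real d * h 0 + (\<Sum>k<m. real (v k) * h (- 1 - int k))"
    and fin: "finite {i. c i \<noteq> 0}" for h :: "int \<Rightarrow> real"
    using two_sided_sum[of N c m] u(2) v(2) unfolding c by blast+
  have "(\<Sum>i | c i \<noteq> 0. real (c i) * \<phi> powi i) = real N"
    unfolding split powi_split using v(3) by (simp add: z_def)
  moreover have "d \<in> {0, 1}" using r by (auto simp: d_def)
  then have "c i \<in> {0, 1}" for i
    using admissible_01[OF u(1)] admissible_01[OF v(1)] by (auto simp: c_def)
  ultimately have "represents c N" using fin by (simp add: represents_def)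
  moreover have "(\<Sum>i | c i \<noteq> 0. real (c i) * \<psi> powi i) = real N"
    unfolding split powi_split using v(4) by (simp add: z'_def)
  moreover have "\<not> (c (i + 1) = 1 \<and> c i = 1)" if "i \<noteq> 0" for i
  proof -
    consider "i > 0" | "i = - 1" | "i < - 1" using \<open>i \<noteq> 0\<close> by linarith
    then show ?thesis
    proof cases
      case 1
      then have "nat (i + 1 - 1) = Suc (nat (i - 1))" by simp
      then show ?thesis using 1 admissible_Suc[OF u(1), of "nat (i - 1)"] by (auto simp: c_def)
    next
      case 2
      then show ?thesis using f(3) v(5) by (auto simp: c_def)
    next
      case 3
      then have "nat (- 1 - i) = Suc (nat (- 1 - (i + 1)))" by simp
      then show ?thesis using 3 admissible_Suc[OF v(1), of "nat (- 1 - (i + 1))"] by (auto simp: c_def)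
    qed
  qed
  moreover have "r = of_bool (c 1 = 1 \<and> c 0 = 1)" using r by (auto simp: c_def d_def)
  ultimately have "good c N" by (simp add: good_def c r_def)
  then show ?thesis by blast
qed

text \<open>A good string with the pair 11 is canonical by uniqueness. If a good string lacks it, no
  string with the pair can exist: both would have the same upper digits, but tail equations
  differing by 1.\<close>

lemma canonical_good:
  assumes "1 \<le> N"
  shows "good (canonical N) N"
proof -
  obtain c where c: "good c N" using good_exists assms by blast
  show ?thesis
  proof (cases "c 1 = 1 \<and> c 0 = 1")
    case True
    then have "is_canonical11 c N" using c by (auto simp: good_def is_canonical11_def)
    then have "canonical N = c"
      unfolding canonical_def using is_canonical11_unique by (auto intro!: the_equality)
    then show ?thesis using c by simp
  next
    case False
    have "False" if "is_canonical11 e N" for e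
    proof -
      have e: "represents e N" "\<forall>i. i \<noteq> 0 \<longrightarrow> \<not> (e (i + 1) = 1 \<and> e i = 1)" "e 1 = 1"
        using that by (auto simp: is_canonical11_def)
      have adm: "admissible (\<lambda>k. e (1 + int k))" "admissible (\<lambda>k. c (1 + int k))"
        using admissible_upper e c by (auto simp: good_def)
      have "upper.fits (int N - 1) (\<lambda>k. e (1 + int k)) 0"
        using canonical11_upper_tail[OF that] e(3) by (simp add: upper.fits_def upper.D_def)
      then have agree: "e (1 + int k) = c (1 + int k)" for k
        using upper.fits_unique[OF adm _ good_upper_fits[OF c], of k] by simp
      then have "c 1 = 1" using e(3) agree[of 0] by simp
      then show False using canonical11_upper_tail[OF that] c False by (simp add: good_def agree)
    qed
    then have none: "\<not> (\<exists>e. is_canonical11 e N)" by blast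
    have "is_bergman c N" using c False unfolding good_def is_bergman_def by (metis add_0)
    then have "canonical N = c"
      unfolding canonical_def bergman_def using none is_bergman_unique by (auto intro!: the_equality)
    then show ?thesis using c by simp
  qed
qed

section \<open>Vertical runs\<close>

text \<open>The second claim identifies every run that meets the interval. The alternative
  \<open>a = 1\<close> is for runs cut off by the start of the sequence.\<close>

lemma vertical_run_interval:
  assumes "1 \<le> a" "a < b" "\<And>N. a \<le> N \<Longrightarrow> N < b \<Longrightarrow> canonical N i = 1"
    "a = 1 \<or> canonical (a - 1) i \<noteq> 1" "canonical b i \<noteq> 1"
  shows "vertical_run i {a..<b}"
    and "\<And>R N. vertical_run i R \<Longrightarrow> N \<in> R \<Longrightarrow> a \<le> N \<Longrightarrow> N < b \<Longrightarrow> R = {a..<b}"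
proof -
  have block: "ones_block i {a..<b}"
    using assms(1-3) by (auto simp: ones_block_def consecutive_def)
  have sub: "S \<subseteq> {a..<b}" if S: "ones_block i S" and N: "N \<in> S" "a \<le> N" "N < b" for S N
  proof
    fix M assume M: "M \<in> S"
    have cons: "{x..y} \<subseteq> S" if "x \<in> S" "y \<in> S" for x y
      using S that by (simp add: ones_block_def consecutive_def)
    have one: "1 \<le> x \<and> canonical x i = 1" if "x \<in> S" for x
      using S that by (simp add: ones_block_def)
    have "a \<le> M"
    proof (rule ccontr)
      assume "\<not> a \<le> M"
      then have "a - 1 \<in> {M..N}" using N by auto
      then have "canonical (a - 1) i = 1" using cons[OF M N(1)] one by blast
      then show False using assms(4) one[OF M] \<open>\<not> a \<le> M\<close> by auto
    qed
    moreover have "M < b"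
    proof (rule ccontr)
      assume "\<not> M < b"
      then have "b \<in> {N..M}" using N by auto
      then show False using cons[OF N(1) M] one assms(5) by blast
    qed
    ultimately show "M \<in> {a..<b}" by simp
  qed
  show "vertical_run i {a..<b}"
    unfolding vertical_run_def using block sub[of _ a] assms(2)
    by (metis atLeastLessThan_iff order_refl subset_antisym subsetD)
  show "R = {a..<b}" if "vertical_run i R" "N \<in> R" "a \<le> N" "N < b" for R N
    using that block sub[of R N] unfolding vertical_run_def by blast
qed

lemma vertical_run_nonempty:
  assumes "vertical_run i R"
  obtains N where "N \<in> R" "1 \<le> N" "canonical N i = 1"
  using assms that unfolding vertical_run_def ones_block_def by blast

lemma upper_run:
  assumes "1 \<le> N" "canonical N (1 + int m) = 1"
  obtains a b where "a \<le> N" "N < b" "b = a + lucas m" "vertical_run (1 + int m) {a..<b}"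
    "\<And>R. vertical_run (1 + int m) R \<Longrightarrow> N \<in> R \<Longrightarrow> R = {a..<b}"
proof -
  define c where "c n = (\<lambda>k. canonical (Suc n) (1 + int k))" for n
  have c: "admissible (c n)" "upper.fits (int n) (c n) 0" for n
  proof -
    have g: "good (canonical (Suc n)) (Suc n)" by (rule canonical_good) simp
    then show "admissible (c n)" unfolding c_def good_def by (blast intro: admissible_upper)
    show "upper.fits (int n) (c n) 0" using good_upper_fits[OF g] by (simp add: c_def)
  qed
  have "c (N - 1) m = 1" using assms by (simp add: c_def)
  with c obtain a where a: "a \<le> int (N - 1)" "int (N - 1) < a + int (lucas m)"
      "\<And>x. a \<le> int x \<Longrightarrow> int x < a + int (lucas m) \<Longrightarrow> c x m = 1"
      "\<And>x. int x = a - 1 \<or> int x = a + int (lucas m) \<Longrightarrow> c x m \<noteq> 1"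
    by (rule upper.digit_run) blast
  \<comment> \<open>The number 0 of the upper numeration has only zero digits, so no interval of
    ones contains it.\<close>
  have "admissible (\<lambda>_. 0)" by (simp add: admissible_def)
  then have "c 0 m = 0"
    using upper.fits_unique[OF c(1)[of 0] _ c(2)[of 0], of "\<lambda>_. 0" m]
    by (simp add: upper.fits_def upper.tail_def upper.D_def)
  then have "0 < a" using a(2) a(3)[of 0] by (cases "a \<le> 0") auto
  \<comment> \<open>The number \<open>n\<close> of the upper numeration stands for
    \<open>N = n + 1\<close>.\<close>
  define A where "A = Suc (nat a)"
  have run: "1 \<le> A" "A < A + lucas m" "\<And>x. A \<le> x \<Longrightarrow> x < A + lucas m \<Longrightarrow> canonical x (1 + int m) = 1"
    "A = 1 \<or> canonical (A - 1) (1 + int m) \<noteq> 1" "canonical (A + lucas m) (1 + int m) \<noteq> 1"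
  proof -
    show "1 \<le> A" "A < A + lucas m" using lucas_pos by (simp_all add: A_def)
    show "canonical x (1 + int m) = 1" if "A \<le> x" "x < A + lucas m" for x
      using a(3)[of "x - 1"] that \<open>0 < a\<close> by (simp add: A_def c_def of_nat_diff)
    show "A = 1 \<or> canonical (A - 1) (1 + int m) \<noteq> 1"
      using a(4)[of "nat a - 1"] \<open>0 < a\<close> by (simp add: A_def c_def)
    show "canonical (A + lucas m) (1 + int m) \<noteq> 1"
      using a(4)[of "nat a + lucas m"] \<open>0 < a\<close> by (simp add: A_def c_def)
  qed
  show thesis
  proof (rule that[of A "A + lucas m"])
    show N: "A \<le> N" "N < A + lucas m" using a(1,2) \<open>0 < a\<close> assms(1) by (auto simp: A_def)
    show "vertical_run (1 + int m) {A..<A + lucas m}" by (rule vertical_run_interval[OF run])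
    show "R = {A..<A + lucas m}" if "vertical_run (1 + int m) R" "N \<in> R" for R
      using vertical_run_interval(2)[OF run] that N by blast
  qed simp
qed

text \<open>For \<open>N - 1 = lucas (m + 1)\<close>, the weight of place \<open>m\<close>, the
  string with a single 1 at that place fits.\<close>

lemma upper_run_exists: "\<exists>N\<ge>1. canonical N (1 + int m) = 1"
proof -
  have "admissible ((\<lambda>_. 0)(m := 1))"
    by (rule admissible_upd_1) (simp_all add: admissible_def)
  moreover define v :: "nat \<Rightarrow> nat" where "v = (\<lambda>_. 0)(m := 1)"
  ultimately have v: "admissible v" by simp
  have "upper.tail (Suc m) v = 0" by (simp add: upper.tail_def v_def)
  then have "upper.fits (int (lucas (Suc m))) v m"
    using upper.fits_1[OF v, of m] lucas_pos[of m] by (simp add: v_def upper.D_def)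
  moreover define N where "N = Suc (lucas (Suc m))"
  moreover have g: "good (canonical N) N" using canonical_good by (simp add: N_def)
  then have adm: "admissible (\<lambda>k. canonical N (1 + int k))" using admissible_upper by (auto simp: good_def)
  moreover have "upper.fits (int (lucas (Suc m))) (\<lambda>k. canonical N (1 + int k)) m"
    using upper.fits_mono[OF adm good_upper_fits[OF g], of m] by (simp add: N_def)
  ultimately have "canonical N (1 + int m) = v m"
    using upper.fits_unique[OF adm v] by blast
  then show ?thesis by (intro exI[of _ N]) (simp add: v_def N_def)
qed

lemma lower_run:
  assumes "1 \<le> N" "canonical N (- int m) = 1"
  obtains a b where "a \<le> N" "N < b" "b = a + lucas m \<or> m = 0 \<and> a = 1 \<and> b = 2"
    "vertical_run (- int m) {a..<b}"
    "\<And>R. vertical_run (- int m) R \<Longrightarrow> N \<in> R \<Longrightarrow> R = {a..<b}"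
proof -
  text \<open>The string \<open>1\<close> at place 0 extends the alternating expansion to the number 0; being
    adjacent to \<open>N = 1\<close> it causes the exceptional run.\<close>
  define c where "c n = (if n = 0 then (\<lambda>_. 0)(0 := 1) else (\<lambda>k. canonical n (- int k)))" for n
  have "admissible ((\<lambda>_. 0)(0 := 1))" by (rule admissible_upd_1) (simp_all add: admissible_def)
  moreover have "lower.fits 0 ((\<lambda>_. 0)(0 := 1)) 0"
    by (simp add: lower.fits_def lower.D_def lower.tail_0_eq[of 1])
  moreover have "admissible (\<lambda>k. canonical n (- int k))" "lower.fits (int n) (\<lambda>k. canonical n (- int k)) 0"
    if "n \<noteq> 0" for n
  proof -
    have g: "good (canonical n) n" using that by (intro canonical_good) simp
    then show "admissible (\<lambda>k. canonical n (- int k))"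
      unfolding good_def by (blast intro: admissible_lower)
    show "lower.fits (int n) (\<lambda>k. canonical n (- int k)) 0" using g by (rule good_lower_fits)
  qed
  ultimately have c: "admissible (c n)" "lower.fits (int n) (c n) 0" for n
    by (cases "n = 0"; simp add: c_def)+
  have "c N m = 1" using assms by (simp add: c_def)
  with c obtain a where a: "a \<le> int N" "int N < a + int (lucas m)"
      "\<And>x. a \<le> int x \<Longrightarrow> int x < a + int (lucas m) \<Longrightarrow> c x m = 1"
      "\<And>x. int x = a - 1 \<or> int x = a + int (lucas m) \<Longrightarrow> c x m \<noteq> 1"
    by (rule lower.digit_run) blast
  have a0: "0 < a \<or> m = 0 \<and> a = 0"
  proof (cases "m = 0")
    case True
    then show ?thesis using a(4)[of 0] a(2) assms(1) by (auto simp: c_def)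
  next
    case False
    then have "c 0 m = 0" by (simp add: c_def)
    then show ?thesis using a(2) a(3)[of 0] by (cases "a \<le> 0") auto
  qed
  \<comment> \<open>The number 0 is cut off. For \<open>m = 0\<close> and \<open>a = 0\<close> this
    leaves only {1} out of {0, 1}.\<close>
  define A B where "A = max 1 (nat a)" and "B = nat a + lucas m"
  have run: "1 \<le> A" "A < B" "\<And>x. A \<le> x \<Longrightarrow> x < B \<Longrightarrow> canonical x (- int m) = 1"
    "A = 1 \<or> canonical (A - 1) (- int m) \<noteq> 1" "canonical B (- int m) \<noteq> 1"
  proof -
    show "1 \<le> A" by (simp add: A_def)
    show "A < B" using a0 lucas_pos[of m] by (auto simp: A_def B_def)
    show "canonical x (- int m) = 1" if "A \<le> x" "x < B" for x
      using a(3)[of x] that a0 by (auto simp: A_def B_def c_def split: if_splits)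
    show "A = 1 \<or> canonical (A - 1) (- int m) \<noteq> 1"
      using a(4)[of "nat a - 1"] a0 by (auto simp: A_def c_def split: if_splits)
    show "canonical B (- int m) \<noteq> 1"
      using a(4)[of B] a0 lucas_pos[of m] by (auto simp: B_def c_def split: if_splits)
  qed
  show thesis
  proof (rule that[of A B])
    show N: "A \<le> N" "N < B" using a(1,2) a0 assms(1) by (auto simp: A_def B_def)
    show "B = A + lucas m \<or> m = 0 \<and> A = 1 \<and> B = 2" using a0 by (auto simp: A_def B_def)
    show "vertical_run (- int m) {A..<B}" by (rule vertical_run_interval[OF run])
    show "R = {A..<B}" if "vertical_run (- int m) R" "N \<in> R" for R
      using vertical_run_interval(2)[OF run] that N by blast
  qed
qed

text \<open>The lower numeration gives 1 = L_0 - 1 and 2 = L_2 - 1, so the digit at place 0 is 1 for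
  the number 1 and 0 for the number 2.\<close>

lemma vertical_run_0_1: "vertical_run 0 {1}"
proof -
  have g: "good (canonical 1) 1" "good (canonical 2) 2" by (rule canonical_good; simp)+
  then have adm: "admissible (\<lambda>k. canonical 1 (- int k))" "admissible (\<lambda>k. canonical 2 (- int k))"
    unfolding good_def by (blast intro: admissible_lower)+
  have v: "admissible ((\<lambda>_. 0)(0 := 1))" "admissible ((\<lambda>_. 0)(2 := 1))"
    by (rule admissible_upd_1; simp add: admissible_def)+
  have "lower.fits 1 ((\<lambda>_. 0)(0 := 1)) 0"
    by (simp add: lower.fits_def lower.D_def lower.tail_0_eq[of 1])
  then have one: "canonical 1 0 = 1"
    using lower.fits_unique[OF adm(1) v(1) _ _ order_refl, of 1 0] good_lower_fits[OF g(1)] by simp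
  have "lower.tail 0 ((\<lambda>_. 0)(2 := 1)) = 3"
    by (subst lower.tail_0_eq[of 3]) (simp_all add: eval_nat_numeral)
  then have "lower.fits 2 ((\<lambda>_. 0)(2 := 1)) 0"
    by (simp add: lower.fits_def lower.D_def)
  then have two: "canonical 2 0 = 0"
    using lower.fits_unique[OF adm(2) v(2) _ _ order_refl, of 2 0] good_lower_fits[OF g(2)] by simp
  have "vertical_run 0 {1..<2}"
  proof (rule vertical_run_interval)
    show "canonical N 0 = 1" if "1 \<le> N" "N < 2" for N
    proof -
      have "N = 1" using that by simp
      then show ?thesis using one by simp
    qed
  qed (use two in simp_all)
  moreover have "{1..<2::nat} = {1}" by auto
  ultimately show ?thesis by simp
qed

theorem theorem12:
  shows "(\<forall>i\<ge>1. \<forall>R. vertical_run i R \<longrightarrow> finite R \<and> card R = lucas (nat (i - 1)))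
    \<and> (\<forall>i\<le>0. \<forall>R. vertical_run i R \<and> \<not> (i = 0 \<and> R = {1}) \<longrightarrow>
          finite R \<and> card R = lucas (nat (- i)))
    \<and> vertical_run 0 {1}
    \<and> (\<forall>i R. vertical_run i R \<and> \<not> (i = 0 \<and> R = {1}) \<longrightarrow>
          finite R \<and> (\<exists>n. card R = lucas n))
    \<and> (\<forall>n. \<exists>i R. vertical_run i R \<and> \<not> (i = 0 \<and> R = {1}) \<and>
          finite R \<and> card R = lucas n)"
proof -
  have pos: "finite R \<and> card R = lucas (nat (i - 1))" if i: "1 \<le> i" and R: "vertical_run i R" for i R
  proof -
    define m where "m = nat (i - 1)"
    have im: "i = 1 + int m" using i by (simp add: m_def)
    obtain N where N: "N \<in> R" "1 \<le> N" "canonical N i = 1" using R by (rule vertical_run_nonempty)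
    obtain a b where ab: "b = a + lucas m" and all: "\<And>S. vertical_run i S \<Longrightarrow> N \<in> S \<Longrightarrow> S = {a..<b}"
      using N(2,3) unfolding im by (rule upper_run) blast
    have "R = {a..<b}" using all R N(1) by blast
    then show ?thesis using ab by (simp add: m_def)
  qed
  have neg: "finite R \<and> card R = lucas (nat (- i))"
    if i: "i \<le> 0" and R: "vertical_run i R" and ne: "\<not> (i = 0 \<and> R = {1})" for i R
  proof -
    define m where "m = nat (- i)"
    have im: "i = - int m" using i by (simp add: m_def)
    obtain N where N: "N \<in> R" "1 \<le> N" "canonical N i = 1" using R by (rule vertical_run_nonempty)
    obtain a b where ab: "b = a + lucas m \<or> m = 0 \<and> a = 1 \<and> b = 2"
      and all: "\<And>S. vertical_run i S \<Longrightarrow> N \<in> S \<Longrightarrow> S = {a..<b}"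
      using N(2,3) unfolding im by (rule lower_run) blast
    have eq: "R = {a..<b}" using all R N(1) by blast
    have "{1..<2::nat} = {1}" by auto
    then have "b = a + lucas m" using ab ne eq im by auto
    then show ?thesis using eq by (simp add: m_def)
  qed
  \<comment> \<open>Position \<open>1 + int n\<close> realises \<open>lucas n\<close>; being
    positive, it avoids the exception.\<close>
  have "\<exists>i R. vertical_run i R \<and> \<not> (i = 0 \<and> R = {1}) \<and> finite R \<and> card R = lucas n" for n
  proof -
    obtain N where N: "1 \<le> N" "canonical N (1 + int n) = 1" using upper_run_exists by blast
    obtain a b where "vertical_run (1 + int n) {a..<b}" using N by (rule upper_run)
    then show ?thesis using pos[of "1 + int n" "{a..<b}"]
      by (intro exI[of _ "1 + int n"] exI[of _ "{a..<b}"]) simp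
  qed
  moreover have "finite R \<and> (\<exists>n. card R = lucas n)"
    if "vertical_run i R" "\<not> (i = 0 \<and> R = {1})" for i R
  proof (cases "1 \<le> i")
    case True
    then show ?thesis using pos that by blast
  next
    case False
    then have "i \<le> 0" by simp
    then show ?thesis using neg that by blast
  qed
  ultimately show ?thesis using pos neg vertical_run_0_1 by blast
qed

end
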